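(* Let $A=CR$ be a random $m\times n$ matrix of rank one over $\mathbb{F}_q$, each such matrix being equally probable, where $C$ is a non-zero column vector of length $m$ and $R$ is a non-zero row vector of length $n$ whose leading non-zero entry is $1$. Then the weight of $A$ is the product of the weights of $C$ and $R$, and $$\mathbf{P}(\mathrm{wt}\,A=\omega)=\sum_{\mu\nu=\omega}\mathbf{P}(\mathrm{wt}\,C=\mu)\,\mathbf{P}(\mathrm{wt}\,R=\nu)=\sum_{\mu\nu=\omega}\binom{m}{\mu}\binom{n}{\nu}\frac{(q-1)^{m+n-\mu-\nu}q^{\mu+\nu}}{(q^{m}-1)(q^{n}-1)}.$$
   Context: $\mathbb{F}_q$ is the finite field with $q$ elements. The weight $\mathrm{wt}$ of a matrix or vector over $\mathbb{F}_q$ is the number of its non-zero entries. Every $m\times n$ matrix $A$ of rank one factors uniquely as $A=CR$ with $C$ and $R$ as in the claim, so that $a_{ij}=c_i r_j$; choosing $A$ uniformly among the rank one matrices amounts to choosing $C$ and $R$ independently and uniformly among the vectors of the stated kinds. The sums are over pairs of positive integers $(\mu,\nu)$ with product $\omega$, where $\omega$ is a positive integer, $\mu\le m$ and $\nu\le n$.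
   Formalization: In the last sum the numerator (q-1)^{m+n-μ-ν} q^{μ+ν} is replaced by (q-1)^{μ+ν}; as printed the formula is false, since for m=n=ω=1 it gives q²/(q-1)² > 1 instead of 1. *)

theory Defs
  imports
    "HOL-Probability.Probability_Mass_Function"
    "Jordan_Normal_Form.DL_Rank"
begin

text \<open>
  The field with \<open>q\<close> elements is a type \<open>'a\<close> of sort \<open>{field, finite}\<close> with \<open>q = CARD('a)\<close>.
  Column vectors of length \<open>m\<close> are \<open>m \<times> 1\<close> matrices and row vectors of length \<open>n\<close> are
  \<open>1 \<times> n\<close> matrices, so that \<open>C * R\<close> is the ordinary matrix product and one notion of weight
  serves for all three. Rows and columns are indexed from \<open>0\<close>.
\<close>

definition wt :: "'a::zero mat \<Rightarrow> nat" where
  "wt A = card {(i, j). i < dim_row A \<and> j < dim_col A \<and> A $$ (i, j) \<noteq> 0}"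

definition rank_one_mats :: "nat \<Rightarrow> nat \<Rightarrow> 'a::field mat set" where
  "rank_one_mats m n = {A \<in> carrier_mat m n. vec_space.rank m A = 1}"

definition nonzero_cols :: "nat \<Rightarrow> 'a::field mat set" where
  "nonzero_cols m = {C \<in> carrier_mat m 1. C \<noteq> 0\<^sub>m m 1}"

definition leading_entry :: "'a::zero mat \<Rightarrow> 'a" where
  "leading_entry R = R $$ (0, LEAST j. j < dim_col R \<and> R $$ (0, j) \<noteq> 0)"

definition monic_rows :: "nat \<Rightarrow> 'a::field mat set" where
  "monic_rows n = {R \<in> carrier_mat 1 n. R \<noteq> 0\<^sub>m 1 n \<and> leading_entry R = 1}"

text \<open>
  The factors \<open>C\<close> and \<open>R\<close> of a rank one matrix \<open>A = C * R\<close>, as functions of \<open>A\<close>; under a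
  distribution of \<open>A\<close> they are random variables on the same probability space.
\<close>

definition rank_one_factors :: "'a::field mat \<Rightarrow> 'a mat \<times> 'a mat" where
  "rank_one_factors A = (THE (C, R).
     C \<in> nonzero_cols (dim_row A) \<and> R \<in> monic_rows (dim_col A) \<and> A = C * R)"

definition col_factor :: "'a::field mat \<Rightarrow> 'a mat" where
  "col_factor A = fst (rank_one_factors A)"

definition row_factor :: "'a::field mat \<Rightarrow> 'a mat" where
  "row_factor A = snd (rank_one_factors A)"

definition random_rank_one :: "nat \<Rightarrow> nat \<Rightarrow> 'a::{field, finite} mat pmf" where
  "random_rank_one m n = pmf_of_set (rank_one_mats m n)"

definition factor_pairs :: "nat \<Rightarrow> nat \<Rightarrow> nat \<Rightarrow> (nat \<times> nat) set" where
  "factor_pairs m n \<omega> = {(\<mu>, \<nu>). 0 < \<mu> \<and> \<mu> \<le> m \<and> 0 < \<nu> \<and> \<nu> \<le> n \<and> \<mu> * \<nu> = \<omega>}"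

text \<open>
  There are \<open>(m choose \<mu>) * (q - 1) ^ \<mu>\<close> columns of weight \<open>\<mu>\<close> among the \<open>q ^ m - 1\<close> non-zero ones,
  and \<open>(n choose \<nu>) * (q - 1) ^ (\<nu> - 1)\<close> normalised rows of weight \<open>\<nu>\<close> among \<open>(q ^ n - 1) / (q - 1)\<close>.
  Pitfall: the numerator in the last member of the theorem is therefore \<open>(q - 1) ^ (\<mu> + \<nu>)\<close>. The source
  prints \<open>(q - 1) ^ (m + n - \<mu> - \<nu>) * q ^ (\<mu> + \<nu>)\<close> in its place, which cannot be right: for
  \<open>m = n = \<omega> = 1\<close> it makes the probability \<open>(q / (q - 1))\<^sup>2 > 1\<close>.
\<close>

end

theory Submission
  imports Defs "HOL-Probability.Product_PMF"
begin

text \<open>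
  A matrix has rank one exactly when it is a product \<open>C * R\<close> of a non-zero column and a non-zero row,
  and normalising the leading entry of \<open>R\<close> to \<open>1\<close> uses up the freedom to move a scalar from one factor
  to the other. So multiplication is a bijection from pairs \<open>(C, R)\<close> onto the matrices of rank one
  (\<open>bij_betw_factors\<close>), and it carries the uniform distribution on the product set to the uniform
  distribution on rank one matrices: the factors of a random matrix of rank one are independent
  and uniform (\<open>map_pmf_rank_one_factors\<close>). An entry \<open>c\<^sub>i r\<^sub>j\<close> is non-zero exactly when both
  factors are, so weights multiply (\<open>wt_col_times_row\<close>), and the first formula is the decomposition
  of the event \<open>wt C * wt R = \<omega>\<close> according to the two weights.

  For the explicit formula it remains to count. A matrix of given weight is a choice of support and of a
  non-zero value at each place of the support (\<open>card_mats_of_wt\<close>), which settles the columns. For the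
  normalised rows the bijection is used once more, now with \<open>m = 1\<close>: a \<open>1 \<times> n\<close> matrix of rank one is
  just a non-zero row, and a non-zero \<open>1 \<times> 1\<close> column is a non-zero scalar. Hence scaling makes
  \<open>q - 1\<close> non-zero rows of the same weight out of each normalised row, and this factor \<open>q - 1\<close> cancels
  in the probability, which is why rows and columns contribute terms of the same shape.
\<close>

section \<open>Matrices of rank one are products of a column and a row\<close>

lemma index_col_times_row:
  fixes C R :: "'a::field mat"
  assumes "C \<in> carrier_mat m 1" "R \<in> carrier_mat 1 n" "i < m" "k < n"
  shows "(C * R) $$ (i, k) = C $$ (i, 0) * R $$ (0, k)"
  using assms by (simp add: scalar_prod_def)

lemma nonzero_mat_obtains_entry:
  assumes "A \<in> carrier_mat m n" "A \<noteq> 0\<^sub>m m n"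
  obtains i k where "i < m" "k < n" "A $$ (i, k) \<noteq> 0"
proof -
  have "\<exists>i<m. \<exists>k<n. A $$ (i, k) \<noteq> 0"
  proof (rule ccontr)
    assume "\<not> ?thesis"
    then have "A = 0\<^sub>m m n" using assms(1) by (intro eq_matI) auto
    with assms(2) show False by simp
  qed
  then show thesis using that by blast
qed

lemma (in vec_space) col_lin_indpt:
  assumes "A \<in> carrier_mat n nc" "i < n" "k < nc" "A $$ (i, k) \<noteq> 0"
  shows "lin_indpt {col A k}"
proof -
  have "col A k $ i \<noteq> 0" using assms by simp
  then have "col A k \<noteq> 0\<^sub>v n" using assms(2) by auto
  moreover have "lin_indpt {}" using finite_lin_indpt2[of "{}"] by auto
  moreover have "col A k \<in> carrier_vec n" using assms by auto
  ultimately show ?thesis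
    using lin_dep_iff_in_span[of "{}" "col A k"] span_empty by auto
qed

lemma (in vec_space) rank_eq_0_iff:
  assumes "A \<in> carrier_mat n nc"
  shows "rank A = 0 \<longleftrightarrow> A = 0\<^sub>m n nc"
proof
  assume 0: "rank A = 0"
  show "A = 0\<^sub>m n nc"
  proof (rule ccontr)
    assume "A \<noteq> 0\<^sub>m n nc"
    then obtain i k where ik: "i < n" "k < nc" "A $$ (i, k) \<noteq> 0"
      using nonzero_mat_obtains_entry[OF assms] by blast
    have "col A k \<in> set (cols A)"
      using assms ik(2) by (auto simp: cols_def)
    then have "card {col A k} \<le> rank A"
      using rank_ge_card_indpt[OF assms, of "{col A k}"] col_lin_indpt[OF assms ik] by simp
    with 0 show False by simp
  qed
qed (simp add: rank_0I)

text \<open>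
  Two distinct independent columns would force rank at least two, so every column lies in the span of
  any one non-zero column.
\<close>

lemma (in vec_space) rank_one_cols_parallel:
  assumes A: "A \<in> carrier_mat n nc" and "rank A = 1"
    and ij: "i < n" "j < nc" "A $$ (i, j) \<noteq> 0" and k: "k < nc"
  shows "\<exists>a. \<forall>i<n. A $$ (i, k) = A $$ (i, j) * a"
proof (cases "col A k = col A j")
  case True
  then have "\<forall>i<n. A $$ (i, k) = A $$ (i, j) * 1"
    using A ij(2) k by (metis carrier_matD index_col mult.right_neutral)
  then show ?thesis by blast
next
  case False
  have carr: "col A k \<in> carrier_vec n" "col A j \<in> carrier_vec n" using A by auto
  have "{col A k, col A j} \<subseteq> set (cols A)"
    using A ij(2) k by (auto simp: cols_def)
  then have "lin_dep (insert (col A k) {col A j})"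
    using rank_ge_card_indpt[OF A, of "{col A k, col A j}"] False \<open>rank A = 1\<close> by auto
  then have "col A k \<in> span {col A j}"
    using lin_dep_iff_in_span[of "{col A j}" "col A k"] col_lin_indpt[OF A ij] False carr by auto
  then obtain a where a: "col A k = lincomb a {col A j}"
    using finite_span[of "{col A j}"] carr by auto
  have "A $$ (i, k) = A $$ (i, j) * a (col A j)" if "i < n" for i
  proof -
    have "A $$ (i, k) = col A k $ i" using A k that by simp
    also have "\<dots> = a (col A j) * col A j $ i"
      unfolding a using lincomb_index[OF that, of "{col A j}" a] carr by simp
    finally show ?thesis using A ij(2) that by simp
  qed
  then show ?thesis by blast
qed

lemma monic_row_leading:
  assumes "R \<in> monic_rows n"
  defines "j \<equiv> LEAST j. j < n \<and> R $$ (0, j) \<noteq> 0"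
  shows "j < n" "R $$ (0, j) = 1"
proof -
  have R: "R \<in> carrier_mat 1 n" "R \<noteq> 0\<^sub>m 1 n" "leading_entry R = 1"
    using assms(1) by (auto simp: monic_rows_def)
  obtain i k where "i < 1" "k < n" "R $$ (i, k) \<noteq> 0"
    using nonzero_mat_obtains_entry[OF R(1,2)] by blast
  then have "\<exists>k. k < n \<and> R $$ (0, k) \<noteq> 0" by auto
  then have "j < n \<and> R $$ (0, j) \<noteq> 0" unfolding j_def by (rule LeastI_ex)
  then show "j < n" by simp
  show "R $$ (0, j) = 1" using R by (simp add: leading_entry_def j_def)
qed

lemma nonzero_col_entry:
  assumes "C \<in> nonzero_cols m"
  obtains i where "i < m" "C $$ (i, 0) \<noteq> 0"
  using assms nonzero_mat_obtains_entry[of C m 1] by (auto simp: nonzero_cols_def)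

text \<open>
  Take for \<open>C\<close> the first non-zero column of \<open>A\<close> and for \<open>R\<close> the ratios of the columns to it. The ratio
  vanishes at the earlier, zero, columns and is \<open>1\<close> at the chosen one, so this choice is what makes \<open>R\<close>
  normalised.
\<close>

lemma rank_one_factors_exist:
  assumes "A \<in> rank_one_mats m n"
  obtains C R where "C \<in> nonzero_cols m" "R \<in> monic_rows n" "A = C * R"
proof -
  interpret vec_space "TYPE('a)" m .
  have A: "A \<in> carrier_mat m n" and rk: "rank A = 1"
    using assms by (auto simp: rank_one_mats_def)
  have "A \<noteq> 0\<^sub>m m n" using rank_eq_0_iff[OF A] rk by auto
  define nz where "nz k \<longleftrightarrow> k < n \<and> (\<exists>i<m. A $$ (i, k) \<noteq> 0)" for k
  define j where "j = (LEAST k. nz k)"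
  have "\<exists>k. nz k"
    using nonzero_mat_obtains_entry[OF A \<open>A \<noteq> 0\<^sub>m m n\<close>] unfolding nz_def by metis
  then have "nz j" unfolding j_def by (rule LeastI_ex)
  then obtain i where ij: "i < m" "j < n" "A $$ (i, j) \<noteq> 0" by (auto simp: nz_def)
  have "\<forall>k<n. \<exists>a. \<forall>i<m. A $$ (i, k) = A $$ (i, j) * a"
    using rank_one_cols_parallel[OF A rk ij] by blast
  then obtain r where r: "\<And>i k. i < m \<Longrightarrow> k < n \<Longrightarrow> A $$ (i, k) = A $$ (i, j) * r k" by metis
  define C where "C = mat m 1 (\<lambda>(i, _). A $$ (i, j))"
  define R where "R = mat 1 n (\<lambda>(_, k). r k)"
  have CR: "C \<in> carrier_mat m 1" "R \<in> carrier_mat 1 n" by (auto simp: C_def R_def)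
  have "C $$ (i, 0) \<noteq> 0" using ij by (simp add: C_def)
  then have C: "C \<in> nonzero_cols m" using CR ij(1) by (auto simp: nonzero_cols_def)
  have rj: "r j = 1" using r[OF ij(1,2)] ij(3) by simp
  have r_nz: "r k \<noteq> 0 \<longleftrightarrow> nz k" if "k < n" for k
  proof -
    have "A $$ (i', k) = 0 \<longleftrightarrow> A $$ (i', j) = 0 \<or> r k = 0" if "i' < m" for i'
      by (subst r[OF that \<open>k < n\<close>]) (rule mult_eq_0_iff)
    then show ?thesis using that ij(1,3) by (auto simp: nz_def)
  qed
  have "k < dim_col R \<and> R $$ (0, k) \<noteq> 0 \<longleftrightarrow> nz k" for k
    using r_nz[of k] by (cases "k < n") (simp_all add: R_def nz_def)
  then have "leading_entry R = R $$ (0, j)"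
    by (simp only: leading_entry_def j_def)
  then have "leading_entry R = 1"
    using rj ij(2) by (simp add: R_def)
  moreover have "R $$ (0, j) \<noteq> 0" using rj ij(2) by (simp add: R_def)
  ultimately have R: "R \<in> monic_rows n" using CR ij(2) by (auto simp: monic_rows_def)
  have "A = C * R"
  proof (rule eq_matI)
    show "dim_row A = dim_row (C * R)" "dim_col A = dim_col (C * R)"
      using A CR by auto
    fix i k assume "i < dim_row (C * R)" "k < dim_col (C * R)"
    then have "i < m" "k < n" using CR by auto
    then show "A $$ (i, k) = (C * R) $$ (i, k)"
      by (subst index_col_times_row[OF CR]) (auto simp: C_def R_def intro: r)
  qed
  with C R show thesis using that by blast
qed

lemma col_times_row_rank_one:
  fixes C R :: "'a::field mat"
  assumes "C \<in> nonzero_cols m" "R \<in> monic_rows n"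
  shows "C * R \<in> rank_one_mats m n"
proof -
  interpret vec_space "TYPE('a)" m .
  have C: "C \<in> carrier_mat m 1" and R: "R \<in> carrier_mat 1 n"
    using assms by (auto simp: nonzero_cols_def monic_rows_def)
  then have CR: "C * R \<in> carrier_mat m n" by simp
  have "rank (C * R) \<le> 1"
    by (rule rank_le_1_product_entries[OF CR, of "\<lambda>i. C $$ (i, 0)" "\<lambda>k. R $$ (0, k)"])
      (use C R index_col_times_row[OF C R] in auto)
  moreover obtain i where i: "i < m" "C $$ (i, 0) \<noteq> 0"
    using nonzero_col_entry[OF assms(1)] .
  define j where "j = (LEAST j. j < n \<and> R $$ (0, j) \<noteq> 0)"
  have j: "j < n" "R $$ (0, j) = 1"
    unfolding j_def by (fact monic_row_leading[OF assms(2)])+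
  have "(C * R) $$ (i, j) \<noteq> 0" using index_col_times_row[OF C R i(1) j(1)] i j by simp
  then have "C * R \<noteq> 0\<^sub>m m n" using i(1) j(1) by auto
  then have "rank (C * R) \<noteq> 0" using rank_eq_0_iff[OF CR] by simp
  ultimately show ?thesis using CR by (simp add: rank_one_mats_def)
qed

text \<open>
  Since \<open>C\<close> has a non-zero entry, \<open>R\<close> vanishes at exactly the places where \<open>C * R\<close> has a zero column.
  The product therefore determines the leading place \<open>j\<close> of \<open>R\<close>, then \<open>C\<close> as its column \<open>j\<close>, and then
  \<open>R\<close> by cancelling a non-zero entry of \<open>C\<close>.
\<close>

lemma rank_one_factors_unique:
  assumes C: "C \<in> nonzero_cols m" "C' \<in> nonzero_cols m"
    and R: "R \<in> monic_rows n" "R' \<in> monic_rows n"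
    and eq: "C * R = C' * R'"
  shows "C = C'" "R = R'"
proof -
  have carr: "C \<in> carrier_mat m 1" "C' \<in> carrier_mat m 1"
      "R \<in> carrier_mat 1 n" "R' \<in> carrier_mat 1 n"
    using C R by (auto simp: nonzero_cols_def monic_rows_def)
  have ent: "C $$ (i, 0) * R $$ (0, k) = C' $$ (i, 0) * R' $$ (0, k)" if "i < m" "k < n" for i k
    using index_col_times_row[of C m R n i k] index_col_times_row[of C' m R' n i k]
      carr that eq by simp
  obtain i where i: "i < m" "C $$ (i, 0) \<noteq> 0" using nonzero_col_entry[OF C(1)] .
  obtain i' where i': "i' < m" "C' $$ (i', 0) \<noteq> 0" using nonzero_col_entry[OF C(2)] .
  have "R $$ (0, k) \<noteq> 0 \<longleftrightarrow> R' $$ (0, k) \<noteq> 0" if "k < n" for k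
    using ent[OF i(1) that] ent[OF i'(1) that] i(2) i'(2) by force
  then have "(\<lambda>k. k < n \<and> R $$ (0, k) \<noteq> 0) = (\<lambda>k. k < n \<and> R' $$ (0, k) \<noteq> 0)"
    by auto
  then obtain j where j: "j < n" "R $$ (0, j) = 1" "R' $$ (0, j) = 1"
    using monic_row_leading[OF R(1)] monic_row_leading[OF R(2)] by metis
  have Ceq: "C $$ (i, 0) = C' $$ (i, 0)" if "i < m" for i
    using ent[OF that j(1)] j by simp
  then show "C = C'" using carr by (intro eq_matI) auto
  have "R $$ (0, k) = R' $$ (0, k)" if "k < n" for k
    using ent[OF i(1) that] Ceq[OF i(1)] i(2) by simp
  then show "R = R'" using carr by (intro eq_matI) auto
qed

lemma bij_betw_factors:
  "bij_betw (\<lambda>(C, R). C * R) (nonzero_cols m \<times> monic_rows n)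
     (rank_one_mats m n :: 'a::field mat set)"
  unfolding bij_betw_def
proof
  show "inj_on (\<lambda>(C, R). C * R) (nonzero_cols m \<times> (monic_rows n :: 'a mat set))"
  proof (rule inj_onI, clarify)
    fix C R C' R' :: "'a mat"
    assume "C \<in> nonzero_cols m" "R \<in> monic_rows n" "C' \<in> nonzero_cols m" "R' \<in> monic_rows n"
      and "C * R = C' * R'"
    then show "C = C' \<and> R = R'" using rank_one_factors_unique by blast
  qed
  show "(\<lambda>(C, R). C * R) ` (nonzero_cols m \<times> monic_rows n) = (rank_one_mats m n :: 'a mat set)"
  proof (intro equalityI subsetI)
    fix A :: "'a mat" assume "A \<in> rank_one_mats m n"
    then obtain C R where "C \<in> nonzero_cols m" "R \<in> monic_rows n" "A = C * R"
      by (rule rank_one_factors_exist)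
    then show "A \<in> (\<lambda>(C, R). C * R) ` (nonzero_cols m \<times> monic_rows n)"
      by (intro image_eqI[of _ _ "(C, R)"]) simp_all
  next
    fix A :: "'a mat" assume "A \<in> (\<lambda>(C, R). C * R) ` (nonzero_cols m \<times> monic_rows n)"
    then show "A \<in> rank_one_mats m n"
      by (elim imageE SigmaE) (simp add: col_times_row_rank_one)
  qed
qed

lemma rank_one_factors_times:
  assumes "C \<in> nonzero_cols m" "R \<in> monic_rows n"
  shows "rank_one_factors (C * R) = (C, R :: 'a::field mat)"
proof -
  have dims: "dim_row (C * R) = m" "dim_col (C * R) = n"
    using assms by (auto simp: nonzero_cols_def monic_rows_def)
  show ?thesis
    unfolding rank_one_factors_def dims
  proof (rule the_equality)
    fix x :: "'a mat \<times> 'a mat"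
    assume "case x of (C', R') \<Rightarrow> C' \<in> nonzero_cols m \<and> R' \<in> monic_rows n \<and> C * R = C' * R'"
    then have "fst x \<in> nonzero_cols m" "snd x \<in> monic_rows n" "C * R = fst x * snd x"
      by (simp_all add: case_prod_unfold)
    then have "C = fst x" "R = snd x"
      using rank_one_factors_unique[OF assms(1) _ assms(2)] by blast+
    then show "x = (C, R)" by simp
  qed (simp add: assms)
qed

lemma wt_col_times_row:
  fixes C R :: "'a::field mat"
  assumes "C \<in> carrier_mat m 1" "R \<in> carrier_mat 1 n"
  shows "wt (C * R) = wt C * wt R"
proof -
  let ?I = "{i. i < m \<and> C $$ (i, 0) \<noteq> 0}" and ?K = "{k. k < n \<and> R $$ (0, k) \<noteq> 0}"
  have "{(i, k). i < dim_row (C * R) \<and> k < dim_col (C * R) \<and> (C * R) $$ (i, k) \<noteq> 0} = ?I \<times> ?K"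
    using assms by (auto simp: index_col_times_row[OF assms] simp del: index_mult_mat(1))
  then have "wt (C * R) = card ?I * card ?K"
    by (simp add: wt_def card_cartesian_product)
  moreover have "{(i, j). i < dim_row C \<and> j < dim_col C \<and> C $$ (i, j) \<noteq> 0} = ?I \<times> {0}"
    using assms by auto
  then have "wt C = card ?I" by (simp add: wt_def card_cartesian_product)
  moreover have "{(i, j). i < dim_row R \<and> j < dim_col R \<and> R $$ (i, j) \<noteq> 0} = {0} \<times> ?K"
    using assms by auto
  then have "wt R = card ?K" by (simp add: wt_def card_cartesian_product)
  ultimately show ?thesis by simp
qed

section \<open>Counting matrices by weight\<close>

text \<open>
  One count serves both for all matrices (every \<open>T p\<close> the whole field) and for the matrices with a
  prescribed support (\<open>T p\<close> either \<open>{0}\<close> or its complement).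
\<close>

lemma card_mats_with_entries_in:
  fixes T :: "nat \<times> nat \<Rightarrow> 'a set"
  shows "card {A \<in> carrier_mat m n. \<forall>p \<in> {..<m} \<times> {..<n}. A $$ p \<in> T p}
    = (\<Prod>p \<in> {..<m} \<times> {..<n}. card (T p))"
proof -
  let ?I = "{..<m} \<times> {..<n}"
  have "bij_betw (mat m n) (Pi\<^sub>E ?I T) {A \<in> carrier_mat m n. \<forall>p \<in> ?I. A $$ p \<in> T p}"
  proof (rule bij_betw_byWitness[where f' = "\<lambda>A. restrict (\<lambda>p. A $$ p) ?I"])
    show "\<forall>f\<in>Pi\<^sub>E ?I T. restrict (\<lambda>p. mat m n f $$ p) ?I = f"
    proof
      fix f assume f: "f \<in> Pi\<^sub>E ?I T"
      show "restrict (\<lambda>p. mat m n f $$ p) ?I = f"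
      proof
        fix p show "restrict (\<lambda>p. mat m n f $$ p) ?I p = f p"
          using PiE_arb[OF f, of p] by (cases p) auto
      qed
    qed
    show "\<forall>A\<in>{A \<in> carrier_mat m n. \<forall>p \<in> ?I. A $$ p \<in> T p}. mat m n (restrict (\<lambda>p. A $$ p) ?I) = A"
    proof
      fix A :: "'a mat" assume "A \<in> {A \<in> carrier_mat m n. \<forall>p \<in> ?I. A $$ p \<in> T p}"
      then show "mat m n (restrict (\<lambda>p. A $$ p) ?I) = A" by (intro eq_matI) auto
    qed
    show "mat m n ` Pi\<^sub>E ?I T \<subseteq> {A \<in> carrier_mat m n. \<forall>p \<in> ?I. A $$ p \<in> T p}"
      by (auto simp: PiE_iff)
    show "(\<lambda>A. restrict (\<lambda>p. A $$ p) ?I) ` {A \<in> carrier_mat m n. \<forall>p \<in> ?I. A $$ p \<in> T p} \<subseteq> Pi\<^sub>E ?I T"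
      by (auto simp only: restrict_PiE_iff image_subset_iff mem_Collect_eq)
  qed
  from bij_betw_same_card[OF this] show ?thesis by (simp add: card_PiE)
qed

lemma wt_le:
  assumes "A \<in> carrier_mat m n"
  shows "wt A \<le> m * n"
proof -
  have "wt A \<le> card ({..<m} \<times> {..<n})"
    unfolding wt_def using assms by (intro card_mono) auto
  then show ?thesis by simp
qed

lemma wt_eq_0_iff:
  assumes "A \<in> carrier_mat m n"
  shows "wt A = 0 \<longleftrightarrow> A = 0\<^sub>m m n"
proof -
  have "finite {(i, j). i < dim_row A \<and> j < dim_col A \<and> A $$ (i, j) \<noteq> 0}"
    by (rule finite_subset[of _ "{..<m} \<times> {..<n}"]) (use assms in auto)
  then have "wt A = 0 \<longleftrightarrow> (\<forall>i<m. \<forall>j<n. A $$ (i, j) = 0)"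
    using assms by (auto simp: wt_def)
  also have "\<dots> \<longleftrightarrow> A = 0\<^sub>m m n"
    using assms nonzero_mat_obtains_entry[OF assms] by (metis index_zero_mat(1))
  finally show ?thesis .
qed

lemma wt_zero_mat [simp]: "wt (0\<^sub>m m n) = 0"
  by (simp add: wt_eq_0_iff[of _ m n])

lemma finite_mats: "finite (carrier_mat m n :: 'a::finite mat set)"
proof (rule finite_subset)
  show "(carrier_mat m n :: 'a mat set) \<subseteq> mat m n ` (({..<m} \<times> {..<n}) \<rightarrow>\<^sub>E UNIV)"
  proof
    fix A :: "'a mat" assume "A \<in> carrier_mat m n"
    then have "A = mat m n (restrict (\<lambda>p. A $$ p) ({..<m} \<times> {..<n}))"
      by (intro eq_matI) auto
    then show "A \<in> mat m n ` (({..<m} \<times> {..<n}) \<rightarrow>\<^sub>E UNIV)" by auto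
  qed
qed (intro finite_imageI finite_PiE, auto)

lemma card_mats: "card (carrier_mat m n :: 'a::finite mat set) = CARD('a) ^ (m * n)"
  using card_mats_with_entries_in[of m n "\<lambda>_. UNIV :: 'a set"] by simp

lemma card_mats_of_wt:
  "card {A \<in> carrier_mat m n :: 'a::{zero, finite} mat set. wt A = k}
     = (m * n choose k) * (CARD('a) - 1) ^ k"
proof -
  let ?I = "{..<m} \<times> {..<n}"
  define supp where "supp A = {p \<in> ?I. A $$ p \<noteq> 0}" for A :: "'a mat"
  define F :: "(nat \<times> nat) set \<Rightarrow> 'a mat set" where "F S = {A \<in> carrier_mat m n. supp A = S}" for S
  have wt_supp: "wt A = card (supp A)" if "A \<in> carrier_mat m n" for A
    unfolding wt_def supp_def using that by (intro arg_cong[where f = card]) auto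
  have F: "card (F S) = (CARD('a) - 1) ^ card S" if "S \<subseteq> ?I" for S
  proof -
    have "F S = {A \<in> carrier_mat m n. \<forall>p \<in> ?I. A $$ p \<in> (if p \<in> S then - {0} else {0})}"
      using that unfolding F_def supp_def by (auto split: if_splits)
    then have "card (F S) = (\<Prod>p\<in>?I. card (if p \<in> S then - {0 :: 'a} else {0}))"
      by (simp only: card_mats_with_entries_in)
    also have "\<dots> = (\<Prod>p\<in>?I. if p \<in> S then CARD('a) - 1 else 1)"
      by (intro prod.cong) (auto simp: Compl_eq_Diff_UNIV card_Diff_singleton)
    also have "\<dots> = (\<Prod>p\<in>S. CARD('a) - 1)"
      using that by (subst prod.inter_restrict[symmetric]) (auto simp: Int_absorb1)
    finally show ?thesis by simp
  qed
  have "{A \<in> carrier_mat m n :: 'a mat set. wt A = k} = (\<Union>S\<in>{S. S \<subseteq> ?I \<and> card S = k}. F S)"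
  proof (intro equalityI subsetI)
    fix A :: "'a mat" assume "A \<in> {A \<in> carrier_mat m n. wt A = k}"
    then have "A \<in> F (supp A)" "supp A \<in> {S. S \<subseteq> ?I \<and> card S = k}"
      by (auto simp: F_def wt_supp) (auto simp: supp_def)
    then show "A \<in> (\<Union>S\<in>{S. S \<subseteq> ?I \<and> card S = k}. F S)" by blast
  qed (auto simp: F_def wt_supp)
  also have "card \<dots> = (\<Sum>S\<in>{S. S \<subseteq> ?I \<and> card S = k}. card (F S))"
  proof (rule card_UN_disjoint)
    show "finite {S. S \<subseteq> ?I \<and> card S = k}" by (rule finite_subset[of _ "Pow ?I"]) auto
    show "\<forall>S\<in>{S. S \<subseteq> ?I \<and> card S = k}. finite (F S)"
      unfolding F_def by (intro ballI finite_subset[OF _ finite_mats[of m n]]) auto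
  qed (auto simp: F_def)
  also have "\<dots> = (\<Sum>S\<in>{S. S \<subseteq> ?I \<and> card S = k}. (CARD('a) - 1) ^ k)"
    by (intro sum.cong) (auto simp: F)
  also have "\<dots> = (m * n choose k) * (CARD('a) - 1) ^ k"
    using n_subsets[of ?I k] by simp
  finally show ?thesis .
qed

lemma card_nonzero_mats:
  "card {A \<in> carrier_mat m n :: 'a::{zero, finite} mat set. A \<noteq> 0\<^sub>m m n} = CARD('a) ^ (m * n) - 1"
proof -
  have "{A \<in> carrier_mat m n :: 'a mat set. A \<noteq> 0\<^sub>m m n} = carrier_mat m n - {0\<^sub>m m n}"
    by auto
  then show ?thesis by (simp add: card_mats)
qed

text \<open>
  This is what lets \<open>bij_betw_factors\<close>, taken with \<open>m = 1\<close>, speak about the normalisation of rows.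
\<close>

lemma rank_one_rows:
  "rank_one_mats 1 n = {R \<in> carrier_mat 1 n :: 'a::field mat set. R \<noteq> 0\<^sub>m 1 n}"
proof -
  interpret vec_space "TYPE('a)" 1 .
  have "rank R \<le> 1" if "R \<in> carrier_mat 1 n" for R :: "'a mat"
    by (rule rank_le_1_product_entries[OF that, of "\<lambda>_. 1" "\<lambda>k. R $$ (0, k)"]) (use that in auto)
  then have "rank R = 1 \<longleftrightarrow> R \<noteq> 0\<^sub>m 1 n" if "R \<in> carrier_mat 1 n" for R :: "'a mat"
    using rank_eq_0_iff[OF that] that by force
  then show ?thesis by (auto simp: rank_one_mats_def)
qed

text \<open>
  In \<open>C * R\<close> the factor \<open>C\<close> is a non-zero \<open>1 \<times> 1\<close> matrix, that is, a scalar: each non-zero row is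
  a unique scalar multiple of a normalised one. Both the number of all normalised rows and their number by
  weight come from this, as properties that scaling preserves.
\<close>

lemma card_nonzero_rows_satisfying:
  fixes Q :: "'a::{field, finite} mat \<Rightarrow> bool"
  assumes Q: "\<And>C R. C \<in> nonzero_cols 1 \<Longrightarrow> R \<in> monic_rows n \<Longrightarrow> Q (C * R) = Q R"
  shows "card {R \<in> carrier_mat 1 n. R \<noteq> 0\<^sub>m 1 n \<and> Q R}
    = (CARD('a) - 1) * card {R \<in> monic_rows n. Q R}"
proof -
  have "bij_betw (\<lambda>(C, R). C * R) {x \<in> nonzero_cols 1 \<times> monic_rows n. Q (snd x)}
      {A \<in> rank_one_mats 1 n. Q A}"
    by (rule bij_betw_Collect[OF bij_betw_factors]) (auto simp: Q)
  then have "card {A \<in> rank_one_mats 1 n. Q A}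
      = card {x \<in> (nonzero_cols 1 :: 'a mat set) \<times> monic_rows n. Q (snd x)}"
    by (rule bij_betw_same_card[symmetric])
  also have "{x \<in> (nonzero_cols 1 :: 'a mat set) \<times> monic_rows n. Q (snd x)}
      = nonzero_cols 1 \<times> {R \<in> monic_rows n. Q R}"
    by auto
  also have "card \<dots> = card (nonzero_cols 1 :: 'a mat set) * card {R \<in> monic_rows n. Q R}"
    by (rule card_cartesian_product)
  also have "card (nonzero_cols 1 :: 'a mat set) = CARD('a) - 1"
    using card_nonzero_mats[where m = 1 and n = 1 and ?'a = 'a] by (simp add: nonzero_cols_def)
  also have "{A \<in> rank_one_mats 1 n. Q A} = {R \<in> carrier_mat 1 n. R \<noteq> 0\<^sub>m 1 n \<and> Q R}"
    unfolding rank_one_rows by auto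
  finally show ?thesis .
qed

lemma card_monic_rows:
  "(CARD('a) - 1) * card (monic_rows n :: 'a::{field, finite} mat set) = CARD('a) ^ n - 1"
  using card_nonzero_rows_satisfying[where ?'a = 'a and n = n and Q = "\<lambda>_. True"]
    card_nonzero_mats[where ?'a = 'a and m = 1 and n = n] by simp

lemma card_monic_rows_of_wt:
  assumes "\<nu> > 0"
  shows "(CARD('a) - 1) * card {R \<in> monic_rows n :: 'a::{field, finite} mat set. wt R = \<nu>}
    = (n choose \<nu>) * (CARD('a) - 1) ^ \<nu>"
proof -
  have "wt (C * R) = wt R" if "C \<in> nonzero_cols 1" "R \<in> monic_rows n" for C R :: "'a mat"
  proof -
    have C: "C \<in> carrier_mat 1 1" "C \<noteq> 0\<^sub>m 1 1" and R: "R \<in> carrier_mat 1 n"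
      using that by (auto simp: nonzero_cols_def monic_rows_def)
    have "wt C = 1" using wt_le[OF C(1)] wt_eq_0_iff[OF C(1)] C(2) by simp
    then show ?thesis using wt_col_times_row[OF C(1) R] by simp
  qed
  then have "(CARD('a) - 1) * card {R \<in> monic_rows n :: 'a mat set. wt R = \<nu>}
      = card {R \<in> carrier_mat 1 n :: 'a mat set. R \<noteq> 0\<^sub>m 1 n \<and> wt R = \<nu>}"
    using card_nonzero_rows_satisfying[where ?'a = 'a and n = n and Q = "\<lambda>R. wt R = \<nu>"] by simp
  also have "{R \<in> carrier_mat 1 n :: 'a mat set. R \<noteq> 0\<^sub>m 1 n \<and> wt R = \<nu>}
      = {R \<in> carrier_mat 1 n. wt R = \<nu>}"
    using assms by auto
  finally show ?thesis by (simp add: card_mats_of_wt)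
qed

lemma card_nonzero_cols_of_wt:
  assumes "\<mu> > 0"
  shows "card {C \<in> nonzero_cols m :: 'a::{field, finite} mat set. wt C = \<mu>}
    = (m choose \<mu>) * (CARD('a) - 1) ^ \<mu>"
proof -
  have "{C \<in> nonzero_cols m :: 'a mat set. wt C = \<mu>} = {C \<in> carrier_mat m 1. wt C = \<mu>}"
    using assms by (auto simp: nonzero_cols_def)
  then show ?thesis by (simp add: card_mats_of_wt)
qed

section \<open>The law of the factors\<close>

lemma pair_pmf_of_set:
  assumes "finite A" "A \<noteq> {}" "finite B" "B \<noteq> {}"
  shows "pair_pmf (pmf_of_set A) (pmf_of_set B) = pmf_of_set (A \<times> B)"
proof (rule pmf_eqI)
  fix x show "pmf (pair_pmf (pmf_of_set A) (pmf_of_set B)) x = pmf (pmf_of_set (A \<times> B)) x"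
    using assms by (cases x) (auto simp: pmf_pair indicator_def card_cartesian_product)
qed

lemma two_le_card_field: "2 \<le> CARD('a::{zero_neq_one, finite})"
proof -
  have "card {0, 1 :: 'a} \<le> CARD('a)" by (rule card_mono) auto
  then show ?thesis by simp
qed

lemma finite_nonzero_cols [simp]: "finite (nonzero_cols m :: 'a::{field, finite} mat set)"
  unfolding nonzero_cols_def by (rule finite_subset[OF _ finite_mats]) auto

lemma finite_monic_rows [simp]: "finite (monic_rows n :: 'a::{field, finite} mat set)"
  unfolding monic_rows_def by (rule finite_subset[OF _ finite_mats]) auto

lemma finite_rank_one_mats: "finite (rank_one_mats m n :: 'a::{field, finite} mat set)"
  unfolding rank_one_mats_def by (rule finite_subset[OF _ finite_mats]) auto

lemma nonzero_cols_nonempty: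
  assumes "m > 0"
  shows "(nonzero_cols m :: 'a::{field, finite} mat set) \<noteq> {}"
proof -
  have "1 < CARD('a) ^ m" using two_le_card_field[where ?'a = 'a] assms by (intro one_less_power) auto
  then have "card (nonzero_cols m :: 'a mat set) \<noteq> 0"
    using card_nonzero_mats[where ?'a = 'a and m = m and n = 1] by (simp add: nonzero_cols_def)
  then show ?thesis by auto
qed

lemma monic_rows_nonempty:
  assumes "n > 0"
  shows "(monic_rows n :: 'a::{field, finite} mat set) \<noteq> {}"
proof -
  have "1 < CARD('a) ^ n" using two_le_card_field[where ?'a = 'a] assms by (intro one_less_power) auto
  then have "(CARD('a) - 1) * card (monic_rows n :: 'a mat set) \<noteq> 0"
    unfolding card_monic_rows by simp
  then show ?thesis by auto
qed

text \<open>
  The independence statement behind the theorem: a uniform choice from a product set is an independent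
  uniform choice of the components, and the factorisation is a bijection onto such a set.
\<close>

lemma map_pmf_rank_one_factors:
  assumes "m > 0" "n > 0"
  shows "map_pmf rank_one_factors (random_rank_one m n :: 'a::{field, finite} mat pmf)
    = pair_pmf (pmf_of_set (nonzero_cols m)) (pmf_of_set (monic_rows n))"
proof -
  let ?X = "(nonzero_cols m :: 'a mat set) \<times> (monic_rows n :: 'a mat set)"
  have fin: "finite ?X" "?X \<noteq> {}"
    by (simp_all add: nonzero_cols_nonempty monic_rows_nonempty assms)
  have "random_rank_one m n = map_pmf (\<lambda>(C, R). C * R) (pmf_of_set ?X)"
    unfolding random_rank_one_def using map_pmf_of_set_bij_betw[OF bij_betw_factors fin(2,1)] by simp
  then have "map_pmf rank_one_factors (random_rank_one m n)
      = map_pmf (\<lambda>(C, R). rank_one_factors (C * R)) (pmf_of_set ?X)"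
    by (simp add: pmf.map_comp o_def case_prod_unfold)
  also have "\<dots> = map_pmf (\<lambda>x. x) (pmf_of_set ?X)"
    by (rule map_pmf_cong) (auto simp: set_pmf_of_set[OF fin(2,1)] rank_one_factors_times)
  finally show ?thesis
    by (simp add: pair_pmf_of_set nonzero_cols_nonempty monic_rows_nonempty assms)
qed

lemma rank_one_factorization:
  assumes "A \<in> rank_one_mats m n"
  shows "col_factor A \<in> nonzero_cols m" "row_factor A \<in> monic_rows n"
    "A = col_factor A * row_factor A" "wt A = wt (col_factor A) * wt (row_factor A)"
proof -
  obtain C R where CR: "C \<in> nonzero_cols m" "R \<in> monic_rows n" "A = C * R"
    using rank_one_factors_exist[OF assms] .
  then have "col_factor A = C" "row_factor A = R"
    using rank_one_factors_times[OF CR(1,2)] by (simp_all add: col_factor_def row_factor_def)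
  moreover have "wt (C * R) = wt C * wt R"
    using CR by (intro wt_col_times_row) (auto simp: nonzero_cols_def monic_rows_def)
  ultimately show "col_factor A \<in> nonzero_cols m" "row_factor A \<in> monic_rows n"
    "A = col_factor A * row_factor A" "wt A = wt (col_factor A) * wt (row_factor A)"
    using CR by simp_all
qed

text \<open>
  The events on the right are intersected with the finite support so that they are countable, as the
  product rule for probabilities of rectangles, used in \<open>prob_wt_rank_one\<close>, requires.
\<close>

lemma prob_wt_col_factor:
  assumes "m > 0" "n > 0"
  shows "measure_pmf.prob (random_rank_one m n) {A :: 'a::{field, finite} mat. wt (col_factor A) = \<mu>}
    = measure_pmf.prob (pmf_of_set (nonzero_cols m)) {C \<in> nonzero_cols m :: 'a mat set. wt C = \<mu>}"
proof -
  have "measure_pmf.prob (random_rank_one m n) {A :: 'a mat. wt (col_factor A) = \<mu>}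
      = measure_pmf.prob (map_pmf fst (map_pmf rank_one_factors (random_rank_one m n))) {C :: 'a mat. wt C = \<mu>}"
    by (simp add: vimage_def col_factor_def)
  also have "\<dots> = measure_pmf.prob (pmf_of_set (nonzero_cols m)) {C :: 'a mat. wt C = \<mu>}"
    by (simp only: map_pmf_rank_one_factors[OF assms] map_fst_pair_pmf)
  also have "\<dots> = measure_pmf.prob (pmf_of_set (nonzero_cols m)) {C \<in> nonzero_cols m :: 'a mat set. wt C = \<mu>}"
    by (intro measure_pmf.finite_measure_eq_AE)
      (auto simp: AE_measure_pmf_iff nonzero_cols_nonempty assms)
  finally show ?thesis .
qed

lemma prob_wt_row_factor:
  assumes "m > 0" "n > 0"
  shows "measure_pmf.prob (random_rank_one m n) {A :: 'a::{field, finite} mat. wt (row_factor A) = \<nu>}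
    = measure_pmf.prob (pmf_of_set (monic_rows n)) {R \<in> monic_rows n :: 'a mat set. wt R = \<nu>}"
proof -
  have "measure_pmf.prob (random_rank_one m n) {A :: 'a mat. wt (row_factor A) = \<nu>}
      = measure_pmf.prob (map_pmf snd (map_pmf rank_one_factors (random_rank_one m n))) {R :: 'a mat. wt R = \<nu>}"
    by (simp add: vimage_def row_factor_def)
  also have "\<dots> = measure_pmf.prob (pmf_of_set (monic_rows n)) {R :: 'a mat. wt R = \<nu>}"
    by (simp only: map_pmf_rank_one_factors[OF assms] map_snd_pair_pmf)
  also have "\<dots> = measure_pmf.prob (pmf_of_set (monic_rows n)) {R \<in> monic_rows n :: 'a mat set. wt R = \<nu>}"
    by (intro measure_pmf.finite_measure_eq_AE)
      (auto simp: AE_measure_pmf_iff monic_rows_nonempty assms)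
  finally show ?thesis .
qed

lemma prob_wt_rank_one:
  assumes "m > 0" "n > 0" "\<omega> > 0"
  shows "measure_pmf.prob (random_rank_one m n) {A :: 'a::{field, finite} mat. wt A = \<omega>}
    = (\<Sum>(\<mu>, \<nu>) \<in> factor_pairs m n \<omega>.
         measure_pmf.prob (pmf_of_set (nonzero_cols m)) {C \<in> nonzero_cols m :: 'a mat set. wt C = \<mu>}
       * measure_pmf.prob (pmf_of_set (monic_rows n)) {R \<in> monic_rows n :: 'a mat set. wt R = \<nu>})"
proof -
  let ?X = "nonzero_cols m :: 'a mat set" and ?Y = "monic_rows n :: 'a mat set"
  let ?M = "pair_pmf (pmf_of_set ?X) (pmf_of_set ?Y)"
  define W where "W = (\<lambda>(\<mu>, \<nu>). {C \<in> ?X. wt C = \<mu>} \<times> {R \<in> ?Y. wt R = \<nu>})"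
  have "(rank_one_mats m n :: 'a mat set) \<noteq> {}"
    using bij_betw_imp_surj_on[OF bij_betw_factors[where ?'a = 'a and m = m and n = n]]
      nonzero_cols_nonempty[OF assms(1), where ?'a = 'a] monic_rows_nonempty[OF assms(2), where ?'a = 'a]
    by auto
  then have set_random: "set_pmf (random_rank_one m n) = (rank_one_mats m n :: 'a mat set)"
    unfolding random_rank_one_def by (rule set_pmf_of_set[OF _ finite_rank_one_mats])
  (* A weight never exceeds the length, and as \<omega> > 0 neither weight is 0; so the bounds
     in factor_pairs lose no pair of weights with product \<omega>. *)
  have W_cover: "(\<Union>p \<in> factor_pairs m n \<omega>. W p) = {(C, R). C \<in> ?X \<and> R \<in> ?Y \<and> wt C * wt R = \<omega>}"
    using wt_le[of _ m 1] wt_le[of _ 1 n] \<open>\<omega> > 0\<close>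
    by (force simp: W_def factor_pairs_def nonzero_cols_def monic_rows_def)
  have fin: "finite (factor_pairs m n \<omega>)"
    by (rule finite_subset[of _ "{..m} \<times> {..n}"]) (auto simp: factor_pairs_def)
  have "measure_pmf.prob (random_rank_one m n) {A :: 'a mat. wt A = \<omega>}
      = measure_pmf.prob (random_rank_one m n) (rank_one_factors -` (\<Union>p \<in> factor_pairs m n \<omega>. W p))"
    unfolding W_cover
    by (intro measure_pmf.finite_measure_eq_AE)
      (auto simp: AE_measure_pmf_iff set_random rank_one_factorization
         col_factor_def[symmetric] row_factor_def[symmetric] case_prod_unfold)
  also have "\<dots> = measure_pmf.prob ?M (\<Union>p \<in> factor_pairs m n \<omega>. W p)"
    unfolding map_pmf_rank_one_factors[OF assms(1,2), symmetric] by simp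
  also have "\<dots> = (\<Sum>p \<in> factor_pairs m n \<omega>. measure_pmf.prob ?M (W p))"
    by (intro measure_pmf.finite_measure_finite_Union fin) (auto simp: disjoint_family_on_def W_def)
  finally show ?thesis
    by (simp add: W_def case_prod_unfold measure_pmf_prob_product countable_finite)
qed

section \<open>The weight distribution\<close>

lemma prob_wt_nonzero_col:
  assumes "m > 0" "\<mu> > 0"
  shows "measure_pmf.prob (pmf_of_set (nonzero_cols m)) {C \<in> nonzero_cols m :: 'a::{field, finite} mat set. wt C = \<mu>}
    = real (m choose \<mu>) * (real CARD('a) - 1) ^ \<mu> / (real CARD('a) ^ m - 1)"
proof -
  let ?X = "nonzero_cols m :: 'a mat set"
  have "card ?X = CARD('a) ^ m - 1"
    using card_nonzero_mats[where ?'a = 'a and m = m and n = 1] by (simp add: nonzero_cols_def)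
  then have cX: "real (card ?X) = real CARD('a) ^ m - 1" by (simp add: of_nat_diff)
  have cX': "real (card {C \<in> ?X. wt C = \<mu>}) = real (m choose \<mu>) * (real CARD('a) - 1) ^ \<mu>"
    using assms(2) by (simp add: card_nonzero_cols_of_wt of_nat_diff)
  have "?X \<inter> {C \<in> ?X. wt C = \<mu>} = {C \<in> ?X. wt C = \<mu>}" by auto
  then show ?thesis by (simp add: measure_pmf_of_set nonzero_cols_nonempty assms(1) cX cX')
qed

text \<open>
  Numerator and denominator are known only after multiplication by \<open>q - 1\<close>, so the quotient is
  expanded by this factor.
\<close>

lemma prob_wt_monic_row:
  assumes "n > 0" "\<nu> > 0"
  shows "measure_pmf.prob (pmf_of_set (monic_rows n)) {R \<in> monic_rows n :: 'a::{field, finite} mat set. wt R = \<nu>}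
    = real (n choose \<nu>) * (real CARD('a) - 1) ^ \<nu> / (real CARD('a) ^ n - 1)"
proof -
  let ?Y = "monic_rows n :: 'a mat set" and ?q = "real CARD('a)"
  have q: "?q - 1 \<noteq> 0" using two_le_card_field[where ?'a = 'a] by simp
  have "(?q - 1) * real (card ?Y) = real ((CARD('a) - 1) * card ?Y)" by (simp add: of_nat_diff)
  also have "\<dots> = ?q ^ n - 1" by (simp only: card_monic_rows) (simp add: of_nat_diff)
  finally have cY: "(?q - 1) * real (card ?Y) = ?q ^ n - 1" .
  have "(?q - 1) * real (card {R \<in> ?Y. wt R = \<nu>}) = real ((CARD('a) - 1) * card {R \<in> ?Y. wt R = \<nu>})"
    by (simp add: of_nat_diff)
  also have "\<dots> = real (n choose \<nu>) * (?q - 1) ^ \<nu>"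
    by (simp only: card_monic_rows_of_wt[OF assms(2)]) (simp add: of_nat_diff)
  finally have cY': "(?q - 1) * real (card {R \<in> ?Y. wt R = \<nu>}) = real (n choose \<nu>) * (?q - 1) ^ \<nu>" .
  have "?Y \<inter> {R \<in> ?Y. wt R = \<nu>} = {R \<in> ?Y. wt R = \<nu>}" by auto
  then have "measure_pmf.prob (pmf_of_set ?Y) {R \<in> ?Y. wt R = \<nu>}
      = real (card {R \<in> ?Y. wt R = \<nu>}) / real (card ?Y)"
    by (simp add: measure_pmf_of_set monic_rows_nonempty assms(1))
  also have "\<dots> = ((?q - 1) * real (card {R \<in> ?Y. wt R = \<nu>})) / ((?q - 1) * real (card ?Y))"
    using q by simp
  finally show ?thesis by (simp only: cY cY')
qed

theorem mainTheorem3: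
  fixes m n \<omega> :: nat and q :: real
    and P :: "('a::{field, finite} mat \<Rightarrow> bool) \<Rightarrow> real"
  assumes "m > 0" and "n > 0" and "\<omega> > 0"
  defines "q \<equiv> real CARD('a)"
    and "P \<equiv> (\<lambda>E. measure_pmf.prob (random_rank_one m n) {A. E A})"
  shows "(\<forall>A \<in> (rank_one_mats m n :: 'a mat set).
            col_factor A \<in> nonzero_cols m \<and> row_factor A \<in> monic_rows n
            \<and> A = col_factor A * row_factor A
            \<and> wt A = wt (col_factor A) * wt (row_factor A))
       \<and> P (\<lambda>A. wt A = \<omega>)
            = (\<Sum>(\<mu>, \<nu>) \<in> factor_pairs m n \<omega>.
                 P (\<lambda>A. wt (col_factor A) = \<mu>) * P (\<lambda>A. wt (row_factor A) = \<nu>))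
       \<and> (\<Sum>(\<mu>, \<nu>) \<in> factor_pairs m n \<omega>.
                 P (\<lambda>A. wt (col_factor A) = \<mu>) * P (\<lambda>A. wt (row_factor A) = \<nu>))
            = (\<Sum>(\<mu>, \<nu>) \<in> factor_pairs m n \<omega>.
                 real (m choose \<mu>) * real (n choose \<nu>)
                   * ((q - 1) ^ (\<mu> + \<nu>) / ((q ^ m - 1) * (q ^ n - 1))))"
proof (intro conjI)
  show "\<forall>A \<in> (rank_one_mats m n :: 'a mat set).
            col_factor A \<in> nonzero_cols m \<and> row_factor A \<in> monic_rows n
            \<and> A = col_factor A * row_factor A
            \<and> wt A = wt (col_factor A) * wt (row_factor A)"
    using rank_one_factorization by blast
  show "P (\<lambda>A. wt A = \<omega>)
      = (\<Sum>(\<mu>, \<nu>) \<in> factor_pairs m n \<omega>.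
           P (\<lambda>A. wt (col_factor A) = \<mu>) * P (\<lambda>A. wt (row_factor A) = \<nu>))"
    unfolding P_def prob_wt_col_factor[OF assms(1,2)] prob_wt_row_factor[OF assms(1,2)]
    by (rule prob_wt_rank_one[OF assms(1-3)])
  show "(\<Sum>(\<mu>, \<nu>) \<in> factor_pairs m n \<omega>.
           P (\<lambda>A. wt (col_factor A) = \<mu>) * P (\<lambda>A. wt (row_factor A) = \<nu>))
      = (\<Sum>(\<mu>, \<nu>) \<in> factor_pairs m n \<omega>.
           real (m choose \<mu>) * real (n choose \<nu>)
             * ((q - 1) ^ (\<mu> + \<nu>) / ((q ^ m - 1) * (q ^ n - 1))))"
    unfolding P_def q_def prob_wt_col_factor[OF assms(1,2)] prob_wt_row_factor[OF assms(1,2)]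
    by (intro sum.cong) (auto simp: factor_pairs_def prob_wt_nonzero_col[OF assms(1)]
        prob_wt_monic_row[OF assms(2)] power_add)
qed

end
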